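(* Fix the RDAG model on a coloured DAG $(\mathcal{G},c)$ with compatible colouring $c$, and set $A:=A(\mathcal{G},c)_{\mathrm{SL}}$. Let $Y\in\mathbb{R}^{m\times n}$. If $\lambda a^{\mathsf T}a$ is an MLE given $Y$, where $a\in A$ and $\lambda>0$ is a scalar, then the map $$b\mapsto \lambda\,(a+b-\mathrm{id})^{\mathsf T}(a+b-\mathrm{id})$$ is a bijection from $A_Y$ to the set of MLEs given $Y$.
   Context: $\mathcal{G}=(I,E)$ is a directed acyclic graph (DAG) with vertex set $I=[m]=\{1,\dots,m\}$ and edge set $E$ (no loops, no multiple edges); $j\to i$ denotes an edge from $j$ to $i$. Vertices are ordered so that $j\to i$ implies $j>i$. A coloured DAG $(\mathcal{G},c)$ is a DAG with a map $c: I\cup E\to \mathcal{C}$ to a set of colours; $c(i)$ (also written $c(ii)$) is the colour of vertex $i$ and $c(ij)$ is the colour of the edge $j\to i$. The colouring $c$ is compatible if (i) vertex colours and edge colours are disjoint, and (ii) whenever edges $j\to i$ and $l\to k$ satisfy $c(ij)=c(kl)$, then $c(i)=c(k)$. The RDAG model on $(\mathcal{G},c)$ is the set of all matrices $\Psi=(\mathrm{id}-\Lambda)^{\mathsf T}\Omega^{-1}(\mathrm{id}-\Lambda)$, where $\Lambda\in\mathbb{R}^{m\times m}$ satisfies $\lambda_{ij}=0$ unless $j\to i$ in $\mathcal{G}$ and $\lambda_{ij}=\lambda_{kl}$ whenever edges $j\to i$ and $l\to k$ have the same colour, and $\Omega\in\mathbb{R}^{m\times m}$ is diagonal with positive diagonal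 entries satisfying $\omega_{ii}=\omega_{jj}$ whenever vertices $i,j$ have the same colour. $A(\mathcal{G},c)$ is the set of real invertible $m\times m$ matrices $a$ with $a_{ij}=0$ for $i\ne j$ with $j\not\to i$ in $\mathcal{G}$, and $a_{ij}=a_{kl}$ whenever $c(ij)=c(kl)$ (for vertices and edges). $A(\mathcal{G},c)_{\mathrm{SL}}=\{a\in A(\mathcal{G},c)\mid\det(a)=1\}$. For a set $A$ of matrices, $A_Y=\{a\in A\mid aY=Y\}$. For $Y\in\mathbb{R}^{m\times n}$ ($n\ge1$), the log-likelihood is $\ell_Y(\Psi)=\log\det(\Psi)-\mathrm{tr}(\Psi S_Y)$ with $S_Y=\frac1n YY^{\mathsf T}$; an MLE given $Y$ is a maximiser of $\ell_Y$ over the model. *)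

theory Defs
  imports "HOL-Analysis.Analysis"
begin

text \<open>
  The vertex set \<open>[m]\<close> is the universe of a finite linearly ordered type \<open>'m\<close>. A pair
  \<open>(j, i) \<in> E\<close> is the edge \<open>j \<rightarrow> i\<close>. Following the notation \<open>c(ij)\<close> for the colour of
  \<open>j \<rightarrow> i\<close> and \<open>c(ii)\<close> for that of \<open>i\<close>, a colouring is a function \<open>c :: 'm \<Rightarrow> 'm \<Rightarrow> 'c\<close>
  with the head of the edge first; its value \<open>c i j\<close> is used only if \<open>i = j\<close> or \<open>(j, i) \<in> E\<close>.
\<close>

definition compatible_colouring :: "('m \<times> 'm) set \<Rightarrow> ('m \<Rightarrow> 'm \<Rightarrow> 'c) \<Rightarrow> bool" where
  "compatible_colouring E c \<longleftrightarrow>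
     (\<forall>v i j. (j, i) \<in> E \<longrightarrow> c v v \<noteq> c i j) \<and>
     (\<forall>i j k l. (j, i) \<in> E \<longrightarrow> (l, k) \<in> E \<longrightarrow> c i j = c k l \<longrightarrow> c i i = c k k)"

definition rdag_coefficients ::
    "('m::finite \<times> 'm) set \<Rightarrow> ('m \<Rightarrow> 'm \<Rightarrow> 'c) \<Rightarrow> (real ^ 'm ^ 'm) set" where
  "rdag_coefficients E c = {L.
     (\<forall>i j. (j, i) \<notin> E \<longrightarrow> L $ i $ j = 0) \<and>
     (\<forall>i j k l. (j, i) \<in> E \<longrightarrow> (l, k) \<in> E \<longrightarrow> c i j = c k l \<longrightarrow> L $ i $ j = L $ k $ l)}"

definition rdag_variances :: "('m::finite \<Rightarrow> 'm \<Rightarrow> 'c) \<Rightarrow> (real ^ 'm ^ 'm) set" where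
  "rdag_variances c = {W.
     (\<forall>i j. i \<noteq> j \<longrightarrow> W $ i $ j = 0) \<and>
     (\<forall>i. W $ i $ i > 0) \<and>
     (\<forall>i j. c i i = c j j \<longrightarrow> W $ i $ i = W $ j $ j)}"

definition rdag_model ::
    "('m::finite \<times> 'm) set \<Rightarrow> ('m \<Rightarrow> 'm \<Rightarrow> 'c) \<Rightarrow> (real ^ 'm ^ 'm) set" where
  "rdag_model E c =
     {transpose (mat 1 - L) ** matrix_inv W ** (mat 1 - L) | L W.
        L \<in> rdag_coefficients E c \<and> W \<in> rdag_variances c}"

definition rdag_matrices ::
    "('m::finite \<times> 'm) set \<Rightarrow> ('m \<Rightarrow> 'm \<Rightarrow> 'c) \<Rightarrow> (real ^ 'm ^ 'm) set" where
  "rdag_matrices E c = {a. invertible a \<and>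
     (\<forall>i j. i \<noteq> j \<longrightarrow> (j, i) \<notin> E \<longrightarrow> a $ i $ j = 0) \<and>
     (\<forall>i j k l. i = j \<or> (j, i) \<in> E \<longrightarrow> k = l \<or> (l, k) \<in> E \<longrightarrow>
        c i j = c k l \<longrightarrow> a $ i $ j = a $ k $ l)}"

definition rdag_matrices_SL ::
    "('m::finite \<times> 'm) set \<Rightarrow> ('m \<Rightarrow> 'm \<Rightarrow> 'c) \<Rightarrow> (real ^ 'm ^ 'm) set" where
  "rdag_matrices_SL E c = {a \<in> rdag_matrices E c. det a = 1}"

definition matrix_stabilizer :: "(real ^ 'm ^ 'm) set \<Rightarrow> real ^ 'n ^ 'm \<Rightarrow> (real ^ 'm ^ 'm) set" where
  "matrix_stabilizer A Y = {a \<in> A. a ** Y = Y}"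

text \<open>The columns of \<open>Y\<close> are the samples, so the sample size is \<open>CARD('n)\<close>.\<close>

definition sample_covariance :: "real ^ 'n ^ 'm \<Rightarrow> real ^ 'm ^ 'm" where
  "sample_covariance Y = (1 / real CARD('n)) *\<^sub>R (Y ** transpose Y)"

definition log_likelihood :: "real ^ 'n ^ 'm \<Rightarrow> real ^ 'm ^ 'm \<Rightarrow> real" where
  "log_likelihood Y P = ln (det P) - trace (P ** sample_covariance Y)"

definition rdag_MLEs ::
    "('m::finite \<times> 'm) set \<Rightarrow> ('m \<Rightarrow> 'm \<Rightarrow> 'c) \<Rightarrow> real ^ 'n ^ 'm \<Rightarrow> (real ^ 'm ^ 'm) set" where
  "rdag_MLEs E c Y = {P. is_arg_max (log_likelihood Y) (\<lambda>Q. Q \<in> rdag_model E c) P}"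

end

theory Submission
  imports Defs
begin

text \<open>
  Since edges decrease the order, every coloured matrix is upper triangular. By compatibility, the
  linear space of coloured matrices is closed under scaling rows by factors that depend
  only on the vertex colour. Scaling the rows of \<open>id - \<Lambda>\<close> by \<open>\<omega>\<^sub>i\<^sub>i\<close> to the power \<open>-1/2\<close>
  shows that the model consists of the matrices \<open>x\<^sup>T x\<close> with \<open>x\<close> coloured and of positive diagonal
  (\<open>rdag_model_eq_gram\<close>). In these coordinates the log-likelihood is the sum of the
  \<open>ln (x\<^sub>i\<^sub>i\<^sup>2)\<close> minus \<open>\<parallel>x Y\<parallel>\<^sup>2 / n\<close> (\<open>log_likelihood_gram\<close>), which yields two facts.

  First, the domain is convex and the log-likelihood is strictly concave in the diagonal of \<open>x\<close> and
  in \<open>x Y\<close>, so all MLEs share both (\<open>rdag_MLE_unique\<close>). Secondly, if some coloured \<open>N\<close> with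
  \<open>N Y = 0\<close> had a nonzero diagonal entry, adding \<open>diag(N) N\<close> to \<open>x\<close> would
  increase the likelihood; hence, once an MLE exists, every \<open>b \<in> A\<^sub>Y\<close> has unit diagonal
  (\<open>rdag_MLE_annihilator_diag\<close>).

  Consequently \<open>a + b - id\<close> has the diagonal of \<open>a\<close> and the same product with \<open>Y\<close>, so it
  gives an MLE. Conversely, an MLE determines, after adjusting row signs, a coloured \<open>x\<close> with the
  diagonal of \<open>a\<close> and \<open>x Y = a Y\<close>, and \<open>b = id + x - a\<close> is its preimage. Injectivity is the
  uniqueness of Cholesky factors (\<open>upper_triangular_eqI\<close>).
\<close>

section \<open>Triangular matrices over a finite linear order\<close>

text \<open>Compare the sums over all \<open>i\<close> of the ranks of \<open>i\<close> and of \<open>p i\<close>, which are equal.\<close>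

lemma permutes_increasing_imp_id:
  fixes p :: "'m::{finite,linorder} \<Rightarrow> 'm"
  assumes p: "p permutes UNIV" and le: "\<And>i. i \<le> p i"
  shows "p = id"
proof (rule ccontr)
  assume "p \<noteq> id"
  then obtain i where i: "p i \<noteq> i" by (auto simp: fun_eq_iff)
  let ?r = "\<lambda>i::'m. card {..i}"
  have "sum ?r UNIV < (\<Sum>i\<in>UNIV. ?r (p i))"
  proof (rule sum_strict_mono_ex1)
    show "\<forall>i\<in>UNIV. ?r i \<le> ?r (p i)"
      using le by (auto intro: card_mono)
    have "?r i < ?r (p i)"
      using le[of i] i by (intro psubset_card_mono) auto
    then show "\<exists>i\<in>UNIV. ?r i < ?r (p i)" by blast
  qed simp
  also have "\<dots> = sum ?r UNIV"
    using sum.permute[OF p, of ?r] by (simp add: comp_def)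
  finally show False by simp
qed

text \<open>Zero entries below the diagonal, for the order of the index type.\<close>

definition upper_triangular :: "'a::zero ^ 'm::{finite,linorder} ^ 'm::{finite,linorder} \<Rightarrow> bool" where
  "upper_triangular a \<longleftrightarrow> (\<forall>i j. j < i \<longrightarrow> a $ i $ j = 0)"

lemma det_upper_triangular:
  fixes a :: "'a::comm_ring_1 ^ ('m::{finite,linorder}) ^ ('m::{finite,linorder})"
  assumes tri: "upper_triangular a"
  shows "det a = (\<Prod>i\<in>UNIV. a $ i $ i)"
proof -
  have zero: "(\<Prod>i\<in>UNIV. a $ i $ p i) = 0" if p: "p permutes UNIV" "p \<noteq> id" for p
  proof -
    obtain i where "p i < i"
      using permutes_increasing_imp_id[OF p(1)] p(2) by (meson not_le)
    then show ?thesis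
      using tri unfolding upper_triangular_def by (intro prod_zero) auto
  qed
  have "det a = (\<Sum>p\<in>{id}. of_int (sign p) * (\<Prod>i\<in>UNIV. a $ i $ p i))"
    unfolding det_def
    by (rule sum.mono_neutral_right) (auto simp: finite_permutations permutes_id zero)
  then show ?thesis by simp
qed

text \<open>
  Uniqueness of Cholesky factors, with the diagonal prescribed instead of positive. The rows of the
  factors are compared by induction, row \<open>i\<close> being determined by row \<open>i\<close> of the
  Gram matrix and the rows above.
\<close>

lemma upper_triangular_eqI:
  fixes P Q :: "real ^ ('m::{finite,linorder}) ^ ('m::{finite,linorder})"
  assumes P: "upper_triangular P" and Q: "upper_triangular Q"
    and diag: "\<And>i. P $ i $ i = Q $ i $ i" and nz: "\<And>i. Q $ i $ i \<noteq> 0"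
    and gram: "transpose P ** P = transpose Q ** Q"
  shows "P = Q"
proof -
  have "\<forall>j. P $ i $ j = Q $ i $ j" for i
  proof (induction i rule: measure_induct_rule[where f = "\<lambda>i::'m. card {..<i}"])
    case (less i)
    have IH: "P $ k $ j = Q $ k $ j" if "k < i" for k j
    proof -
      have "card {..<k} < card {..<i}"
        using that by (intro psubset_card_mono) auto
      then show ?thesis using less by blast
    qed
    have split: "(transpose R ** R) $ i $ j
        = R $ i $ i * R $ i $ j + (\<Sum>k\<in>{..<i}. R $ k $ i * R $ k $ j)"
      if R: "upper_triangular R" for R :: "real ^ ('m::{finite,linorder}) ^ ('m::{finite,linorder})" and j
    proof -
      have "(transpose R ** R) $ i $ j = (\<Sum>k\<in>UNIV. R $ k $ i * R $ k $ j)"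
        by (simp add: matrix_matrix_mult_def transpose_def)
      also have "\<dots> = (\<Sum>k\<in>insert i {..<i}. R $ k $ i * R $ k $ j)"
        using R unfolding upper_triangular_def by (intro sum.mono_neutral_right) auto
      finally show ?thesis by simp
    qed
    show ?case
    proof
      fix j
      have "(\<Sum>k\<in>{..<i}. P $ k $ i * P $ k $ j) = (\<Sum>k\<in>{..<i}. Q $ k $ i * Q $ k $ j)"
        using IH by (intro sum.cong) auto
      then have "Q $ i $ i * P $ i $ j = Q $ i $ i * Q $ i $ j"
        using split[OF P, of j] split[OF Q, of j] unfolding gram diag by linarith
      then show "P $ i $ j = Q $ i $ j" using nz[of i] by simp
    qed
  qed
  then show ?thesis by (simp add: vec_eq_iff)
qed

section \<open>The linear space of coloured matrices\<close>

text \<open>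
  The linear space cut out by the support and colour conditions that define \<open>A(\<G>, c)\<close>, without
  invertibility.
\<close>

definition rdag_space ::
    "('m::finite \<times> 'm) set \<Rightarrow> ('m \<Rightarrow> 'm \<Rightarrow> 'c) \<Rightarrow> (real ^ 'm ^ 'm) set" where
  "rdag_space E c = {a.
     (\<forall>i j. i \<noteq> j \<longrightarrow> (j, i) \<notin> E \<longrightarrow> a $ i $ j = 0) \<and>
     (\<forall>i j k l. i = j \<or> (j, i) \<in> E \<longrightarrow> k = l \<or> (l, k) \<in> E \<longrightarrow>
        c i j = c k l \<longrightarrow> a $ i $ j = a $ k $ l)}"

text \<open>Left multiplication by the diagonal matrix with entries \<open>d\<close>.\<close>

definition row_scale :: "('m \<Rightarrow> real) \<Rightarrow> real ^ 'n ^ 'm \<Rightarrow> real ^ 'n ^ 'm" where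
  "row_scale d a = (\<chi> i j. d i * a $ i $ j)"

lemma row_scale_nth [simp]: "row_scale d a $ i $ j = d i * a $ i $ j"
  by (simp add: row_scale_def)

lemma row_scale_mult: "row_scale d a ** Y = row_scale d (a ** Y)"
  by (simp add: vec_eq_iff matrix_matrix_mult_def sum_distrib_left mult.assoc)

lemma gram_row_scale:
  "(transpose (row_scale d a) ** row_scale d a) $ i $ j
     = (\<Sum>k\<in>UNIV. (d k)\<^sup>2 * (a $ k $ i * a $ k $ j))"
  by (simp add: matrix_matrix_mult_def transpose_def power2_eq_square mult.commute mult.left_commute)

lemma rdag_spaceI:
  assumes "\<And>i j. i \<noteq> j \<Longrightarrow> (j, i) \<notin> E \<Longrightarrow> a $ i $ j = 0"
    and "\<And>i j k l. i = j \<or> (j, i) \<in> E \<Longrightarrow> k = l \<or> (l, k) \<in> E \<Longrightarrow>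
      c i j = c k l \<Longrightarrow> a $ i $ j = a $ k $ l"
  shows "a \<in> rdag_space E c"
  unfolding rdag_space_def mem_Collect_eq
  by (intro conjI allI impI; rule assms)

lemma rdag_space_zero:
  "a \<in> rdag_space E c \<Longrightarrow> i \<noteq> j \<Longrightarrow> (j, i) \<notin> E \<Longrightarrow> a $ i $ j = 0"
  unfolding rdag_space_def by blast

lemma rdag_space_eq:
  assumes "a \<in> rdag_space E c" and "i = j \<or> (j, i) \<in> E" "k = l \<or> (l, k) \<in> E"
    and "c i j = c k l"
  shows "a $ i $ j = a $ k $ l"
proof -
  have "\<forall>i j k l. i = j \<or> (j, i) \<in> E \<longrightarrow> k = l \<or> (l, k) \<in> E \<longrightarrow>
      c i j = c k l \<longrightarrow> a $ i $ j = a $ k $ l"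
    using assms(1) unfolding rdag_space_def mem_Collect_eq by (rule conjunct2)
  from this[rule_format, OF assms(2-4)] show ?thesis .
qed

lemma subspace_rdag_space: "subspace (rdag_space E c)"
proof (rule subspaceI)
  fix x y assume xy: "x \<in> rdag_space E c" "y \<in> rdag_space E c"
  show "x + y \<in> rdag_space E c"
  proof (rule rdag_spaceI)
    fix i j k l
    assume *: "i = j \<or> (j, i) \<in> E" "k = l \<or> (l, k) \<in> E" "c i j = c k l"
    show "(x + y) $ i $ j = (x + y) $ k $ l"
      using rdag_space_eq[OF xy(1) *] rdag_space_eq[OF xy(2) *] by simp
  qed (simp add: rdag_space_zero[OF xy(1)] rdag_space_zero[OF xy(2)])
next
  fix r x assume x: "x \<in> rdag_space E c"
  show "r *\<^sub>R x \<in> rdag_space E c"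
  proof (rule rdag_spaceI)
    fix i j k l
    assume *: "i = j \<or> (j, i) \<in> E" "k = l \<or> (l, k) \<in> E" "c i j = c k l"
    show "(r *\<^sub>R x) $ i $ j = (r *\<^sub>R x) $ k $ l"
      using rdag_space_eq[OF x *] by simp
  qed (simp add: rdag_space_zero[OF x])
qed (simp add: rdag_space_def)

lemma rdag_space_diag:
  "a \<in> rdag_space E c \<Longrightarrow> c i i = c k k \<Longrightarrow> a $ i $ i = a $ k $ k"
  using rdag_space_eq[of a E c i i k k] by simp

lemma compatible_colouring_same_colour:
  assumes "compatible_colouring E c"
    and "i = j \<or> (j, i) \<in> E" "k = l \<or> (l, k) \<in> E" "c i j = c k l"
  shows "c i i = c k k \<and> (i = j \<and> k = l \<or> (j, i) \<in> E \<and> (l, k) \<in> E)"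
proof -
  have 1: "\<And>v i j. (j, i) \<in> E \<Longrightarrow> c v v \<noteq> c i j"
    and 2: "\<And>i j k l. (j, i) \<in> E \<Longrightarrow> (l, k) \<in> E \<Longrightarrow> c i j = c k l \<Longrightarrow> c i i = c k k"
    using assms(1) unfolding compatible_colouring_def by blast+
  show ?thesis
  proof (cases "(j, i) \<in> E")
    case True
    then have "(l, k) \<in> E" using assms(3,4) 1[OF True, of k] by auto
    then show ?thesis using 2[OF True _ assms(4)] True by blast
  next
    case False
    then have "i = j" using assms(2) by blast
    moreover have "k = l" using assms(3,4) 1[of l k i] \<open>i = j\<close> by auto
    ultimately show ?thesis using assms(4) by blast
  qed
qed

lemma mat_1_in_rdag_space:
  assumes comp: "compatible_colouring E c" and irr: "\<forall>i j. (j, i) \<in> E \<longrightarrow> i \<noteq> j"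
  shows "mat 1 \<in> rdag_space E c"
proof (rule rdag_spaceI)
  fix i j k l
  assume *: "i = j \<or> (j, i) \<in> E" "k = l \<or> (l, k) \<in> E" "c i j = c k l"
  have "i = j \<longleftrightarrow> k = l"
    using compatible_colouring_same_colour[OF comp *] irr by blast
  then show "mat 1 $ i $ j = mat 1 $ k $ l" by (simp add: mat_def)
qed (simp add: mat_def)

lemma row_scale_in_rdag_space:
  assumes comp: "compatible_colouring E c" and a: "a \<in> rdag_space E c"
    and d: "\<And>i k. c i i = c k k \<Longrightarrow> d i = d k"
  shows "row_scale d a \<in> rdag_space E c"
proof (rule rdag_spaceI)
  fix i j k l
  assume *: "i = j \<or> (j, i) \<in> E" "k = l \<or> (l, k) \<in> E" "c i j = c k l"
  have "d i = d k" using compatible_colouring_same_colour[OF comp *] d by blast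
  then show "row_scale d a $ i $ j = row_scale d a $ k $ l"
    using rdag_space_eq[OF a *] by simp
qed (simp add: rdag_space_zero[OF a])

lemma rdag_space_upper_triangular:
  fixes E :: "('m::{finite,linorder} \<times> 'm) set"
  assumes a: "a \<in> rdag_space E c" and ord: "\<forall>i j. (j, i) \<in> E \<longrightarrow> i < j"
  shows "upper_triangular a"
  unfolding upper_triangular_def
proof (intro allI impI)
  fix i j :: 'm assume "j < i"
  then show "a $ i $ j = 0" using ord by (intro rdag_space_zero[OF a]) (auto dest: less_asym)
qed

lemma rdag_matrices_iff:
  fixes E :: "('m::{finite,linorder} \<times> 'm) set"
  assumes ord: "\<forall>i j. (j, i) \<in> E \<longrightarrow> i < j"
  shows "a \<in> rdag_matrices E c \<longleftrightarrow> a \<in> rdag_space E c \<and> (\<forall>i. a $ i $ i \<noteq> 0)"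
proof -
  have "a \<in> rdag_matrices E c \<longleftrightarrow> a \<in> rdag_space E c \<and> det a \<noteq> 0"
    by (auto simp: rdag_matrices_def rdag_space_def invertible_det_nz)
  moreover have "det a = (\<Prod>i\<in>UNIV. a $ i $ i)" if "a \<in> rdag_space E c"
    by (rule det_upper_triangular[OF rdag_space_upper_triangular[OF that ord]])
  ultimately show ?thesis by auto
qed

section \<open>The model as a set of Gram matrices\<close>

lemma matrix_inverse_unique:
  fixes A B :: "'a::semiring_1 ^ 'n ^ 'n"
  assumes AB: "A ** B = mat 1" and BA: "B ** A = mat 1"
  shows "matrix_inv A = B"
proof -
  have "\<exists>C. A ** C = mat 1 \<and> C ** A = mat 1" using assms by blast
  then have "A ** matrix_inv A = mat 1 \<and> matrix_inv A ** A = mat 1"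
    unfolding matrix_inv_def by (rule someI_ex)
  then show ?thesis by (metis BA matrix_mul_assoc matrix_mul_lid matrix_mul_rid)
qed

text \<open>
  The factor is \<open>x = diag(d) (id - \<Lambda>)\<close> with \<open>d\<^sub>i\<^sup>2 = 1 / \<omega>\<^sub>i\<^sub>i\<close>; compatibility makes \<open>x\<close> coloured,
  and conversely \<open>\<Lambda> = id - diag(x)\<inverse> x\<close>.
\<close>

lemma rdag_model_eq_gram:
  fixes E :: "('m::{finite,linorder} \<times> 'm) set"
  assumes ord: "\<forall>i j. (j, i) \<in> E \<longrightarrow> i < j" and comp: "compatible_colouring E c"
  shows "rdag_model E c =
    {transpose a ** a | a. a \<in> rdag_space E c \<and> (\<forall>i. a $ i $ i > 0)}" (is "_ = ?G")
proof -
  have irr: "i \<noteq> j" if "(j, i) \<in> E" for i j using ord that by blast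
  have one: "mat 1 \<in> rdag_space E c" using irr by (intro mat_1_in_rdag_space[OF comp]) blast
  have coeff: "L \<in> rdag_coefficients E c \<longleftrightarrow> L \<in> rdag_space E c \<and> (\<forall>i. L $ i $ i = 0)" for L
  proof
    assume L: "L \<in> rdag_coefficients E c"
    have z: "L $ i $ i = 0" for i
      using L irr unfolding rdag_coefficients_def by blast
    have "L \<in> rdag_space E c"
    proof (rule rdag_spaceI)
      fix i j k l
      assume *: "i = j \<or> (j, i) \<in> E" "k = l \<or> (l, k) \<in> E" "c i j = c k l"
      consider "i = j" "k = l" | "(j, i) \<in> E" "(l, k) \<in> E"
        using compatible_colouring_same_colour[OF comp *] by blast
      then show "L $ i $ j = L $ k $ l"
      proof cases
        case 2
        then show ?thesis using L *(3) unfolding rdag_coefficients_def mem_Collect_eq by blast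
      qed (simp add: z)
    next
      show "L $ i $ j = 0" if "(j, i) \<notin> E" for i j
        using L that unfolding rdag_coefficients_def mem_Collect_eq by blast
    qed
    then show "L \<in> rdag_space E c \<and> (\<forall>i. L $ i $ i = 0)" using z by blast
  next
    assume L: "L \<in> rdag_space E c \<and> (\<forall>i. L $ i $ i = 0)"
    have "L $ i $ j = 0" if "(j, i) \<notin> E" for i j
      using L that rdag_space_zero[of L E c i j] by (cases "i = j") auto
    moreover have "L $ i $ j = L $ k $ l"
      if "(j, i) \<in> E" "(l, k) \<in> E" "c i j = c k l" for i j k l
      using L that by (intro rdag_space_eq[of L E c]) auto
    ultimately show "L \<in> rdag_coefficients E c"
      unfolding rdag_coefficients_def mem_Collect_eq by blast
  qed
  have inv: "matrix_inv W = (\<chi> i j. if i = j then inverse (W $ i $ i) else 0)"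
    if W: "W \<in> rdag_variances c" for W
  proof (rule matrix_inverse_unique)
    have off: "W $ i $ j = 0" if "i \<noteq> j" for i j
      using W that unfolding rdag_variances_def mem_Collect_eq by blast
    have nz: "W $ i $ i \<noteq> 0" for i
      using W unfolding rdag_variances_def mem_Collect_eq by (metis less_irrefl)
    show "W ** (\<chi> i j. if i = j then inverse (W $ i $ i) else 0) = mat 1"
      unfolding vec_eq_iff
    proof (intro allI)
      fix i j
      have "(W ** (\<chi> i j. if i = j then inverse (W $ i $ i) else 0)) $ i $ j
          = W $ i $ j * inverse (W $ j $ j)"
        by (simp add: matrix_matrix_mult_def if_distrib cong: if_cong)
      then show "(W ** (\<chi> i j. if i = j then inverse (W $ i $ i) else 0)) $ i $ j = mat 1 $ i $ j"
        using off[of i j] nz[of j] by (cases "i = j") (simp_all add: mat_def)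
    qed
    show "(\<chi> i j. if i = j then inverse (W $ i $ i) else 0) ** W = mat 1"
      unfolding vec_eq_iff
    proof (intro allI)
      fix i j
      have "((\<chi> i j. if i = j then inverse (W $ i $ i) else 0) ** W) $ i $ j
          = inverse (W $ i $ i) * W $ i $ j"
        by (simp add: matrix_matrix_mult_def if_distrib if_distribR cong: if_cong)
      then show "((\<chi> i j. if i = j then inverse (W $ i $ i) else 0) ** W) $ i $ j = mat 1 $ i $ j"
        using off[of i j] nz[of i] by (cases "i = j") (simp_all add: mat_def)
    qed
  qed
  have gram: "transpose B ** matrix_inv W ** B = transpose (row_scale d B) ** row_scale d B"
    if W: "W \<in> rdag_variances c" and d: "\<And>i. (d i)\<^sup>2 = inverse (W $ i $ i)"
    for B W :: "real ^ ('m::{finite,linorder}) ^ ('m::{finite,linorder})" and d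
    unfolding vec_eq_iff gram_row_scale d inv[OF W]
    by (simp add: matrix_matrix_mult_def transpose_def if_distrib if_distribR sum.delta
        mult.commute mult.left_commute cong: if_cong)
  show ?thesis
  proof (intro equalityI subsetI)
    fix P assume "P \<in> rdag_model E c"
    then obtain L W where P: "P = transpose (mat 1 - L) ** matrix_inv W ** (mat 1 - L)"
      and L: "L \<in> rdag_coefficients E c" and W: "W \<in> rdag_variances c"
      unfolding rdag_model_def by blast
    define d where "d i = inverse (sqrt (W $ i $ i))" for i
    have pos: "W $ i $ i > 0" for i using W unfolding rdag_variances_def mem_Collect_eq by blast
    have d2: "(d i)\<^sup>2 = inverse (W $ i $ i)" for i
      using pos[of i] by (simp add: d_def power_inverse)
    have dc: "d i = d k" if "c i i = c k k" for i k
    proof -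
      have "W $ i $ i = W $ k $ k"
        using W that unfolding rdag_variances_def mem_Collect_eq by blast
      then show ?thesis by (simp add: d_def)
    qed
    have "mat 1 - L \<in> rdag_space E c"
      using one L coeff subspace_diff[OF subspace_rdag_space] by blast
    then have "row_scale d (mat 1 - L) \<in> rdag_space E c"
      using row_scale_in_rdag_space[OF comp] dc by blast
    moreover have "row_scale d (mat 1 - L) $ i $ i > 0" for i
      using pos[of i] L coeff by (simp add: d_def mat_def)
    ultimately show "P \<in> ?G" using gram[OF W d2] P by blast
  next
    fix P assume "P \<in> ?G"
    then obtain a where P: "P = transpose a ** a" and a: "a \<in> rdag_space E c"
      and pos: "\<And>i. a $ i $ i > 0" by blast
    define L where "L = mat 1 - row_scale (\<lambda>i. inverse (a $ i $ i)) a"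
    define W :: "real ^ ('m::{finite,linorder}) ^ ('m::{finite,linorder})"
      where "W = (\<chi> i j. if i = j then inverse ((a $ i $ i)\<^sup>2) else 0)"
    have nz: "a $ i $ i \<noteq> 0" for i using pos[of i] by simp
    have "row_scale (\<lambda>i. inverse (a $ i $ i)) a \<in> rdag_space E c"
      by (intro row_scale_in_rdag_space[OF comp a]) (use rdag_space_diag[OF a] in metis)
    then have "L \<in> rdag_space E c"
      unfolding L_def using one subspace_diff[OF subspace_rdag_space] by blast
    then have L: "L \<in> rdag_coefficients E c"
      using nz by (simp add: coeff) (simp add: L_def mat_def)
    have W: "W \<in> rdag_variances c"
      unfolding rdag_variances_def mem_Collect_eq
    proof (intro conjI allI impI)
      fix i j assume "c i i = c j j"
      then show "W $ i $ i = W $ j $ j"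
        using rdag_space_diag[OF a, of i j] by (simp add: W_def)
    qed (simp_all add: W_def nz)
    have "row_scale (\<lambda>i. a $ i $ i) (mat 1 - L) = a"
      using nz by (simp add: L_def vec_eq_iff)
    then have "P = transpose (mat 1 - L) ** matrix_inv W ** (mat 1 - L)"
      using gram[OF W, of "\<lambda>i. a $ i $ i" "mat 1 - L"] P by (simp add: W_def)
    then show "P \<in> rdag_model E c" unfolding rdag_model_def using L W by blast
  qed
qed

text \<open>
  Signs of the diagonal can be normalised by a row scaling that is constant on vertex colours,
  so nonzero diagonal entries suffice for membership in the model.
\<close>

lemma gram_in_rdag_model:
  fixes E :: "('m::{finite,linorder} \<times> 'm) set"
  assumes ord: "\<forall>i j. (j, i) \<in> E \<longrightarrow> i < j" and comp: "compatible_colouring E c"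
    and a: "a \<in> rdag_space E c" and nz: "\<And>i. a $ i $ i \<noteq> 0"
  shows "transpose a ** a \<in> rdag_model E c"
proof -
  let ?a = "row_scale (\<lambda>i. sgn (a $ i $ i)) a"
  have "?a \<in> rdag_space E c"
    by (intro row_scale_in_rdag_space[OF comp a]) (use rdag_space_diag[OF a] in metis)
  moreover have "?a $ i $ i > 0" for i
    using nz[of i] by (simp add: sgn_mult_self_eq flip: abs_sgn) (simp add: sgn_if)
  moreover have "transpose ?a ** ?a = transpose a ** a"
  proof -
    have "(sgn (a $ i $ i))\<^sup>2 = 1" for i using nz[of i] by (simp add: sgn_if)
    then show ?thesis
      unfolding vec_eq_iff gram_row_scale
      by (simp add: matrix_matrix_mult_def transpose_def)
  qed
  ultimately show ?thesis unfolding rdag_model_eq_gram[OF ord comp] by (smt (verit) mem_Collect_eq)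
qed

section \<open>The likelihood in triangular coordinates\<close>

lemma log_likelihood_gram:
  fixes a :: "real ^ ('m::{finite,linorder}) ^ ('m::{finite,linorder})" and Y :: "real ^ 'n::finite ^ ('m::{finite,linorder})"
  assumes tri: "upper_triangular a" and nz: "\<And>i. a $ i $ i \<noteq> 0"
  shows "log_likelihood Y (transpose a ** a)
    = (\<Sum>i\<in>UNIV. ln ((a $ i $ i)\<^sup>2)) - (norm (a ** Y))\<^sup>2 / real CARD('n)"
proof -
  have "det (transpose a ** a) = (\<Prod>i\<in>UNIV. (a $ i $ i)\<^sup>2)"
    using det_upper_triangular[OF tri]
    by (simp add: det_mul det_transpose power2_eq_square prod.distrib)
  then have 1: "ln (det (transpose a ** a)) = (\<Sum>i\<in>UNIV. ln ((a $ i $ i)\<^sup>2))"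
    using nz by (simp add: ln_prod)
  have "trace (transpose a ** a ** (Y ** transpose Y)) = trace (a ** Y ** transpose (a ** Y))"
    by (metis matrix_mul_assoc matrix_transpose_mul trace_mul_sym)
  also have "\<dots> = (norm (a ** Y))\<^sup>2"
    unfolding power2_norm_eq_inner inner_vec_def trace_def
    by (subst matrix_matrix_mult_def) (simp add: transpose_def)
  finally have 2: "trace (transpose a ** a ** (Y ** transpose Y)) = (norm (a ** Y))\<^sup>2" .
  have "trace (transpose a ** a ** sample_covariance Y)
      = trace (transpose a ** a ** (Y ** transpose Y)) / real CARD('n)"
    unfolding sample_covariance_def trace_def
    by (subst (1 3) matrix_matrix_mult_def) (simp add: sum_divide_distrib)
  then show ?thesis unfolding log_likelihood_def 1 2 by simp
qed

lemma matrix_add_rdistrib: "(A + B) ** C = A ** C + B ** C"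
  for A B :: "'a::semiring_1 ^ 'n ^ 'm"
  by (simp add: matrix_matrix_mult_def vec_eq_iff distrib_right sum.distrib)

lemma matrix_diff_rdistrib: "(A - B) ** C = A ** C - B ** C"
  for A B :: "'a::ring_1 ^ 'n ^ 'm"
  by (simp add: matrix_matrix_mult_def vec_eq_iff left_diff_distrib sum_subtractf)

lemma rdag_MLEs_iff:
  "P \<in> rdag_MLEs E c Y \<longleftrightarrow>
     P \<in> rdag_model E c \<and> (\<forall>Q\<in>rdag_model E c. log_likelihood Y Q \<le> log_likelihood Y P)"
  by (auto simp: rdag_MLEs_def is_arg_max_def not_less)

lemma ln_midpoint_square:
  fixes x y :: real
  assumes "x > 0" "y > 0"
  shows "(ln (x\<^sup>2) + ln (y\<^sup>2)) / 2 \<le> ln (((x + y) / 2)\<^sup>2)"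
    and "(ln (x\<^sup>2) + ln (y\<^sup>2)) / 2 = ln (((x + y) / 2)\<^sup>2) \<Longrightarrow> x = y"
proof -
  have eq: "(ln (x\<^sup>2) + ln (y\<^sup>2)) / 2 = ln (x * y)"
    using assms by (simp add: ln_mult ln_realpow)
  have "((x + y) / 2)\<^sup>2 - x * y = ((x - y) / 2)\<^sup>2"
    by (simp add: power2_eq_square field_simps)
  then have le: "((x + y) / 2)\<^sup>2 = x * y + ((x - y) / 2)\<^sup>2" by simp
  have pos: "((x + y) / 2)\<^sup>2 > 0" "x * y > 0" using assms by auto
  show "(ln (x\<^sup>2) + ln (y\<^sup>2)) / 2 \<le> ln (((x + y) / 2)\<^sup>2)"
    unfolding eq using pos le by (subst ln_le_cancel_iff) auto
  assume "(ln (x\<^sup>2) + ln (y\<^sup>2)) / 2 = ln (((x + y) / 2)\<^sup>2)"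
  then have "x * y = ((x + y) / 2)\<^sup>2" unfolding eq using pos by (subst (asm) ln_inj_iff) auto
  then show "x = y" using le by simp
qed

text \<open>
  Midpoints of the positive part of the coloured space stay in it, and the likelihood is strictly
  concave in the diagonal and in \<open>a ** Y\<close>; hence these two are the same for all MLEs.
\<close>

lemma rdag_MLE_unique:
  fixes E :: "('m::{finite,linorder} \<times> 'm) set" and Y :: "real ^ 'n::finite ^ ('m::{finite,linorder})"
  assumes ord: "\<forall>i j. (j, i) \<in> E \<longrightarrow> i < j" and comp: "compatible_colouring E c"
    and a: "a \<in> rdag_space E c" "\<And>i. a $ i $ i > 0" "transpose a ** a \<in> rdag_MLEs E c Y"
    and b: "b \<in> rdag_space E c" "\<And>i. b $ i $ i > 0" "transpose b ** b \<in> rdag_MLEs E c Y"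
  shows "(\<forall>i. a $ i $ i = b $ i $ i) \<and> a ** Y = b ** Y"
proof -
  define h where "h = (1 / 2) *\<^sub>R (a + b)"
  define n where "n = real CARD('n)"
  have n: "n > 0" by (simp add: n_def)
  have h: "h \<in> rdag_space E c"
    unfolding h_def using subspace_rdag_space a(1) b(1) by (meson subspace_add subspace_mul)
  have hd: "h $ i $ i = (a $ i $ i + b $ i $ i) / 2" for i by (simp add: h_def)
  have hpos: "h $ i $ i > 0" for i unfolding hd using a(2)[of i] b(2)[of i] by simp
  have ll: "log_likelihood Y (transpose x ** x)
      = (\<Sum>i\<in>UNIV. ln ((x $ i $ i)\<^sup>2)) - (norm (x ** Y))\<^sup>2 / n"
    if "x \<in> rdag_space E c" "\<And>i. x $ i $ i > 0" for x
    unfolding n_def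
  proof (rule log_likelihood_gram[OF rdag_space_upper_triangular[OF that(1) ord]])
    show "x $ i $ i \<noteq> 0" for i using that(2)[of i] by simp
  qed
  have "transpose h ** h \<in> rdag_model E c"
    using h hpos unfolding rdag_model_eq_gram[OF ord comp] by blast
  then have le: "log_likelihood Y (transpose h ** h) \<le> log_likelihood Y (transpose a ** a)"
      "log_likelihood Y (transpose h ** h) \<le> log_likelihood Y (transpose b ** b)"
    using a(3) b(3) by (auto simp: rdag_MLEs_iff)
  \<comment> \<open>The concavity gap of the \<open>i\<close>-th logarithm; the gap of the norm term is the parallelogram law.\<close>
  define g where "g i = ln ((h $ i $ i)\<^sup>2) - (ln ((a $ i $ i)\<^sup>2) + ln ((b $ i $ i)\<^sup>2)) / 2" for i
  have g0: "g i \<ge> 0" for i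
    unfolding g_def hd using ln_midpoint_square(1)[OF a(2) b(2)] by (simp add: algebra_simps)
  have g_sum: "sum g UNIV = (\<Sum>i\<in>UNIV. ln ((h $ i $ i)\<^sup>2))
      - ((\<Sum>i\<in>UNIV. ln ((a $ i $ i)\<^sup>2)) + (\<Sum>i\<in>UNIV. ln ((b $ i $ i)\<^sup>2))) / 2"
    by (simp add: g_def sum_subtractf sum.distrib flip: sum_divide_distrib)
  have "h ** Y = (1 / 2) *\<^sub>R (a ** Y + b ** Y)"
    by (simp add: h_def vec_eq_iff matrix_matrix_mult_def sum.distrib sum_divide_distrib
        algebra_simps)
  then have h_norm: "(norm (h ** Y))\<^sup>2 = ((norm (a ** Y))\<^sup>2 + (norm (b ** Y))\<^sup>2) / 2
      - (norm (a ** Y - b ** Y))\<^sup>2 / 4"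
    by (simp add: power2_norm_eq_inner inner_simps inner_commute field_simps)
  have nrm: "(norm (h ** Y))\<^sup>2 / n
      = ((norm (a ** Y))\<^sup>2 / n + (norm (b ** Y))\<^sup>2 / n) / 2 - (norm (a ** Y - b ** Y))\<^sup>2 / (4 * n)"
    unfolding h_norm using n by (simp add: field_simps)
  have sum0: "sum g UNIV + (norm (a ** Y - b ** Y))\<^sup>2 / (4 * n) \<le> 0"
  proof -
    have arith: "G + d \<le> 0"
      if "F - f \<le> A - r" "F - f \<le> B - t" "G = F - (A + B) / 2" "f = (r + t) / 2 - d"
      for F f A r B t G d :: real
      using that by (simp add: field_simps)
    show ?thesis
      by (rule arith[OF _ _ g_sum nrm])
        (use le in \<open>simp_all only: ll[OF h hpos] ll[OF a(1,2)] ll[OF b(1,2)]\<close>)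
  qed
  have p: "(norm (a ** Y - b ** Y))\<^sup>2 / (4 * n) \<ge> 0" using n by simp
  have q: "sum g UNIV \<ge> 0" using g0 by (simp add: sum_nonneg)
  have "sum g UNIV = 0" using sum0 p q by linarith
  then have "g i = 0" for i using g0 by (simp add: sum_nonneg_eq_0_iff)
  then have "a $ i $ i = b $ i $ i" for i
    using ln_midpoint_square(2)[OF a(2) b(2)] unfolding g_def hd by (metis eq_iff_diff_eq_0)
  moreover have "(norm (a ** Y - b ** Y))\<^sup>2 / (4 * n) = 0" using sum0 p q by linarith
  then have "a ** Y = b ** Y" using n by simp
  ultimately show ?thesis by blast
qed

text \<open>
  If an MLE exists, the diagonal of a coloured matrix that annihilates the data vanishes: otherwise
  a suitable rescaling of its rows could be added to enlarge the determinant without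
  changing the trace term.
\<close>

lemma rdag_MLE_annihilator_diag:
  fixes E :: "('m::{finite,linorder} \<times> 'm) set" and Y :: "real ^ 'n::finite ^ ('m::{finite,linorder})"
  assumes ord: "\<forall>i j. (j, i) \<in> E \<longrightarrow> i < j" and comp: "compatible_colouring E c"
    and ex: "P \<in> rdag_MLEs E c Y"
    and N: "N \<in> rdag_space E c" "N ** Y = 0"
  shows "N $ i $ i = 0"
proof (rule ccontr)
  assume nz: "N $ i $ i \<noteq> 0"
  obtain a where P: "P = transpose a ** a" and a: "a \<in> rdag_space E c" "\<And>i. a $ i $ i > 0"
    using ex unfolding rdag_MLEs_iff rdag_model_eq_gram[OF ord comp] by blast
  \<comment> \<open>Scaling row \<open>i\<close> by \<open>N\<^sub>i\<^sub>i\<close> makes the diagonal entry the square of \<open>N\<^sub>i\<^sub>i\<close>, hence nonnegative.\<close>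
  define N' where "N' = row_scale (\<lambda>i. N $ i $ i) N"
  have N': "N' \<in> rdag_space E c"
    unfolding N'_def
    by (intro row_scale_in_rdag_space[OF comp N(1)]) (rule rdag_space_diag[OF N(1)])
  have N'Y: "N' ** Y = 0" by (simp add: N'_def row_scale_mult N(2) vec_eq_iff)
  have b: "a + N' \<in> rdag_space E c" using a(1) N' subspace_add[OF subspace_rdag_space] by blast
  have bd: "(a + N') $ i $ i = a $ i $ i + (N $ i $ i)\<^sup>2" for i
    by (simp add: N'_def power2_eq_square)
  have bpos: "(a + N') $ i $ i > 0" for i unfolding bd using a(2)[of i] by (simp add: add_pos_nonneg)
  have bY: "(a + N') ** Y = a ** Y" by (simp add: matrix_add_rdistrib N'Y)
  have "transpose (a + N') ** (a + N') \<in> rdag_model E c"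
    using b bpos unfolding rdag_model_eq_gram[OF ord comp] by blast
  then have le: "log_likelihood Y (transpose (a + N') ** (a + N'))
      \<le> log_likelihood Y (transpose a ** a)"
    using ex P by (simp add: rdag_MLEs_iff)
  have "(\<Sum>i\<in>UNIV. ln ((a $ i $ i)\<^sup>2)) < (\<Sum>i\<in>UNIV. ln (((a + N') $ i $ i)\<^sup>2))"
  proof (rule sum_strict_mono_ex1)
    have "(a $ i $ i)\<^sup>2 \<le> ((a + N') $ i $ i)\<^sup>2" for i
      using a(2)[of i] unfolding bd by (intro power_mono) auto
    then have "ln ((a $ i $ i)\<^sup>2) \<le> ln (((a + N') $ i $ i)\<^sup>2)" for i
      using a(2)[of i] bpos[of i] by (subst ln_le_cancel_iff) auto
    then show "\<forall>i\<in>UNIV. ln ((a $ i $ i)\<^sup>2) \<le> ln (((a + N') $ i $ i)\<^sup>2)" by blast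
    have "(a $ i $ i)\<^sup>2 < ((a + N') $ i $ i)\<^sup>2"
      using a(2)[of i] nz unfolding bd by (intro power_strict_mono) auto
    then have "ln ((a $ i $ i)\<^sup>2) < ln (((a + N') $ i $ i)\<^sup>2)"
      using a(2)[of i] bpos[of i] by (subst ln_less_cancel_iff) auto
    then show "\<exists>i\<in>UNIV. ln ((a $ i $ i)\<^sup>2) < ln (((a + N') $ i $ i)\<^sup>2)" by blast
  qed simp
  moreover have nza: "a $ i $ i \<noteq> 0" "(a + N') $ i $ i \<noteq> 0" for i
    using a(2)[of i] bpos[of i] by linarith+
  ultimately show False
    using le bY log_likelihood_gram[OF rdag_space_upper_triangular[OF a(1) ord] nza(1), of Y]
      log_likelihood_gram[OF rdag_space_upper_triangular[OF b ord] nza(2), of Y] by simp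
qed

section \<open>The bijection\<close>

theorem propositionA3:
  fixes E :: "('m::{finite,linorder} \<times> 'm) set"
    and c :: "'m \<Rightarrow> 'm \<Rightarrow> 'c"
    and Y :: "real ^ 'n ^ ('m::{finite,linorder})"
    and a :: "real ^ ('m::{finite,linorder}) ^ ('m::{finite,linorder})"
    and s :: real
  assumes "acyclic E"
    and "\<And>i j. (j, i) \<in> E \<Longrightarrow> j > i"
    and "compatible_colouring E c"
    and "a \<in> rdag_matrices_SL E c"
    and "s > 0"
    and "s *\<^sub>R (transpose a ** a) \<in> rdag_MLEs E c Y"
  shows "bij_betw (\<lambda>b. s *\<^sub>R (transpose (a + b - mat 1) ** (a + b - mat 1)))
           (matrix_stabilizer (rdag_matrices_SL E c) Y) (rdag_MLEs E c Y)"
proof -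
  have ord: "\<forall>i j. (j, i) \<in> E \<longrightarrow> i < j" using assms(2) by blast
  note comp = assms(3)
  let ?S = "matrix_stabilizer (rdag_matrices_SL E c) Y"
  have one: "mat 1 \<in> rdag_space E c"
    using ord by (intro mat_1_in_rdag_space[OF comp]) blast
  note sub = subspace_rdag_space[of E c]
  have a: "a \<in> rdag_space E c" "\<And>i. a $ i $ i \<noteq> 0"
    using assms(4) rdag_matrices_iff[OF ord] by (auto simp: rdag_matrices_SL_def)
  have stab: "b \<in> ?S \<longleftrightarrow> b \<in> rdag_space E c \<and> (\<forall>i. b $ i $ i = 1) \<and> b ** Y = Y" for b
  proof
    assume "b \<in> ?S"
    then have b: "b \<in> rdag_space E c" "b ** Y = Y"
      using rdag_matrices_iff[OF ord] by (auto simp: matrix_stabilizer_def rdag_matrices_SL_def)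
    have "(b - mat 1) ** Y = 0"
      using b(2) by (simp add: matrix_diff_rdistrib)
    then have "(b - mat 1) $ i $ i = 0" for i
      using rdag_MLE_annihilator_diag[OF ord comp assms(6)] subspace_diff[OF sub b(1) one] by blast
    then show "b \<in> rdag_space E c \<and> (\<forall>i. b $ i $ i = 1) \<and> b ** Y = Y"
      using b by (simp add: mat_def)
  next
    assume b: "b \<in> rdag_space E c \<and> (\<forall>i. b $ i $ i = 1) \<and> b ** Y = Y"
    then have "upper_triangular b" using rdag_space_upper_triangular ord by blast
    then have "det b = 1" using b by (simp add: det_upper_triangular)
    then show "b \<in> ?S"
      using b rdag_matrices_iff[OF ord, of b c] by (simp add: matrix_stabilizer_def rdag_matrices_SL_def)
  qed
  have scale: "s *\<^sub>R (transpose x ** x) = transpose (sqrt s *\<^sub>R x) ** (sqrt s *\<^sub>R x)"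
    for x :: "real ^ ('m::{finite,linorder}) ^ ('m::{finite,linorder})"
  proof -
    have "transpose (sqrt s *\<^sub>R x) ** (sqrt s *\<^sub>R x)
        = (sqrt s * sqrt s) *\<^sub>R (transpose x ** x)"
      unfolding transpose_scalar
      by (simp only: matrix_scalar_ac scalar_matrix_assoc[symmetric] scaleR_scaleR)
    then show ?thesis using assms(5) by simp
  qed
  have ll: "log_likelihood Y (s *\<^sub>R (transpose x ** x))
      = (\<Sum>i\<in>UNIV. ln ((sqrt s * x $ i $ i)\<^sup>2)) - (norm (sqrt s *\<^sub>R (x ** Y)))\<^sup>2 / real CARD('n)"
    if "x \<in> rdag_space E c" "\<And>i. x $ i $ i \<noteq> 0" for x
  proof -
    have eq: "(sqrt s *\<^sub>R x) ** Y = sqrt s *\<^sub>R (x ** Y)"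
      by (simp add: vec_eq_iff matrix_matrix_mult_def sum_distrib_left mult.assoc)
    show ?thesis
      unfolding scale using that(2) assms(5)
      by (subst log_likelihood_gram
          [OF rdag_space_upper_triangular[OF subspace_scale[OF sub that(1)] ord]]) (auto simp: eq)
  qed
  show ?thesis
  proof (rule bij_betwI')
    fix b b' assume "b \<in> ?S" "b' \<in> ?S"
    then have b: "b \<in> rdag_space E c" "\<And>i. b $ i $ i = 1"
      and b': "b' \<in> rdag_space E c" "\<And>i. b' $ i $ i = 1" by (auto simp: stab)
    have P: "a + b - mat 1 \<in> rdag_space E c" "a + b' - mat 1 \<in> rdag_space E c"
      using a(1) b(1) b'(1) one sub by (meson subspace_add subspace_diff)+
    show "(s *\<^sub>R (transpose (a + b - mat 1) ** (a + b - mat 1))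
         = s *\<^sub>R (transpose (a + b' - mat 1) ** (a + b' - mat 1))) = (b = b')"
    proof
      assume "s *\<^sub>R (transpose (a + b - mat 1) ** (a + b - mat 1))
         = s *\<^sub>R (transpose (a + b' - mat 1) ** (a + b' - mat 1))"
      then have gram: "transpose (a + b - mat 1) ** (a + b - mat 1)
         = transpose (a + b' - mat 1) ** (a + b' - mat 1)" using assms(5) by simp
      have "a + b - mat 1 = a + b' - mat 1"
      proof (rule upper_triangular_eqI[OF rdag_space_upper_triangular[OF P(1) ord]
            rdag_space_upper_triangular[OF P(2) ord] _ _ gram])
        show "(a + b - mat 1) $ i $ i = (a + b' - mat 1) $ i $ i" for i
          by (simp add: b(2) b'(2))
        show "(a + b' - mat 1) $ i $ i \<noteq> 0" for i
          by (simp add: b'(2) a(2) mat_def)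
      qed
      then show "b = b'" by simp
    qed simp
  next
    fix b assume "b \<in> ?S"
    then have b: "b \<in> rdag_space E c" "\<And>i. b $ i $ i = 1" "b ** Y = Y" by (auto simp: stab)
    define x where "x = a + b - mat 1"
    have x: "x \<in> rdag_space E c"
      unfolding x_def using a(1) b(1) one sub by (meson subspace_add subspace_diff)
    have xd: "x $ i $ i = a $ i $ i" for i by (simp add: x_def b(2) mat_def)
    have xY: "x ** Y = a ** Y"
      by (simp add: x_def matrix_add_rdistrib matrix_diff_rdistrib b(3))
    have "s *\<^sub>R (transpose x ** x) \<in> rdag_model E c"
      unfolding scale using subspace_scale[OF sub x, of "sqrt s"] a(2) assms(5)
      by (intro gram_in_rdag_model[OF ord comp]) (auto simp: xd)
    moreover have "log_likelihood Y (s *\<^sub>R (transpose x ** x))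
        = log_likelihood Y (s *\<^sub>R (transpose a ** a))"
      using ll[OF a] ll[OF x] a(2) by (simp add: xd xY)
    ultimately show "s *\<^sub>R (transpose (a + b - mat 1) ** (a + b - mat 1)) \<in> rdag_MLEs E c Y"
      using assms(6) unfolding x_def[symmetric] rdag_MLEs_iff by simp
  next
    fix P assume P: "P \<in> rdag_MLEs E c Y"
    then obtain p where p: "P = transpose p ** p" "p \<in> rdag_space E c" "\<And>i. p $ i $ i > 0"
      unfolding rdag_MLEs_iff rdag_model_eq_gram[OF ord comp] by blast
    \<comment> \<open>The diagonal of \<open>a\<close> may have negative entries; uniqueness concerns positive factors.\<close>
    define d where "d i = sgn (a $ i $ i)" for i
    have dc: "d i = d k" if "c i i = c k k" for i k
      unfolding d_def using rdag_space_diag[OF a(1) that] by simp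
    have d2: "d i * d i = 1" for i using a(2)[of i] by (simp add: d_def sgn_if)
    have dd: "d i * (d i * r) = r" for i r using d2[of i] by (simp flip: mult.assoc)
    define q where "q = row_scale d (sqrt s *\<^sub>R a)"
    have q: "q \<in> rdag_space E c"
      unfolding q_def using dc subspace_scale[OF sub a(1)] row_scale_in_rdag_space[OF comp] by blast
    have qpos: "q $ i $ i > 0" for i
      using a(2)[of i] assms(5) by (auto simp: q_def d_def sgn_if mult_less_0_iff)
    have gram: "transpose (row_scale d x) ** row_scale d x = transpose x ** x"
      for x :: "real ^ ('m::{finite,linorder}) ^ ('m::{finite,linorder})"
      unfolding vec_eq_iff gram_row_scale power2_eq_square d2
      by (simp add: matrix_matrix_mult_def transpose_def)
    have "transpose q ** q \<in> rdag_MLEs E c Y"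
      using assms(6) by (simp add: q_def gram scale)
    then have u: "\<And>i. p $ i $ i = q $ i $ i" "p ** Y = q ** Y"
      using rdag_MLE_unique[OF ord comp p(2,3) _ q qpos] P p(1) by blast+
    define x where "x = (1 / sqrt s) *\<^sub>R row_scale d p"
    have s: "sqrt s > 0" using assms(5) by simp
    have x: "x \<in> rdag_space E c"
      unfolding x_def using dc subspace_scale[OF sub] row_scale_in_rdag_space[OF comp p(2)] by blast
    have xd: "x $ i $ i = a $ i $ i" for i
      using s by (simp add: x_def u q_def dd)
    have "x ** Y = (1 / sqrt s) *\<^sub>R row_scale d (p ** Y)"
      by (simp add: x_def row_scale_mult[symmetric]) 
        (simp add: vec_eq_iff matrix_matrix_mult_def sum_divide_distrib)
    also have "\<dots> = (1 / sqrt s) *\<^sub>R row_scale d (row_scale d ((sqrt s *\<^sub>R a) ** Y))"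
      by (simp add: u q_def row_scale_mult)
    also have "\<dots> = a ** Y"
      using s by (simp add: vec_eq_iff dd matrix_matrix_mult_def sum_divide_distrib)
    finally have xY: "x ** Y = a ** Y" .
    define b where "b = mat 1 + x - a"
    have "b \<in> ?S"
      unfolding stab
    proof (intro conjI allI)
      show "b \<in> rdag_space E c"
        unfolding b_def using a(1) x one sub by (meson subspace_add subspace_diff)
      show "b $ i $ i = 1" for i by (simp add: b_def xd mat_def)
      show "b ** Y = Y" by (simp add: b_def matrix_add_rdistrib matrix_diff_rdistrib xY)
    qed
    moreover have "a + b - mat 1 = x" by (simp add: b_def)
    moreover have "sqrt s *\<^sub>R x = row_scale d p" using s by (simp add: x_def)
    then have "s *\<^sub>R (transpose x ** x) = P" by (simp add: scale gram p(1))
    ultimately show "\<exists>b\<in>?S. P = s *\<^sub>R (transpose (a + b - mat 1) ** (a + b - mat 1))"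
      by metis
  qed
qed

end
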